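(* Let $(\mathcal{R},\partial,\int)$ be an integro-differential ring (not necessarily commutative). Assume that $a\in\mathcal{R}$ is such that there exists $z\in\mathcal{R}$ that satisfies $\partial z+az=0$ and has a multiplicative right inverse $z^{-1}\in\mathcal{R}$ (i.e. $zz^{-1}=1$). Then, in $\mathcal{R}\langle\partial,\int,\mathrm{E}\rangle$, the operators $L:=\partial+a$ and $H:=z\cdot\int\cdot z^{-1}$ satisfy $$L\cdot H=1.$$
   Context: Rings are unital, nonzero, not necessarily commutative, of arbitrary characteristic. A derivation on a ring $\mathcal{R}$ is an additive map $\partial$ with $\partial(fg)=(\partial f)g+f\,\partial g$; $\mathcal{C}=\{f\in\mathcal{R}:\partial f=0\}$ is the ring of constants. "$\mathcal{C}$-linear" means homomorphism of $\mathcal{C}$-bimodules. An integro-differential ring $(\mathcal{R},\partial,\int)$ is a differential ring together with a $\mathcal{C}$-linear map $\int\colon\mathcal{R}\to\mathcal{R}$ satisfying $\partial\int f=f$ for all $f$. Its induced evaluation is $\mathrm{E}f:=f-\int\partial f\in\mathcal{C}$. The ring of integro-differential operators $\mathcal{R}\langle\partial,\int,\mathrm{E}\rangle$ is the (noncommutative unital) ring extension of $\mathcal{R}$ generated by indeterminates $\partial,\int,\mathrm{E}$ that commute with all elements of $\mathcal{C}$, subject to the identities, for all $f\in\mathcal{R}$: $\partial\cdot f=f\cdot\partial+\partial f$, $\ \partial\cdot\int=1$, $\ \int\cdot\partial=1-\mathrm{E}$, $\ \partial\cdot f\cdot\mathrm{E}=\partial f\cdot\mathrm{E}$, $\ \int\cdot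 f\cdot\mathrm{E}=\int f\cdot\mathrm{E}$, $\ \mathrm{E}\cdot f\cdot\mathrm{E}=\mathrm{E}f\cdot\mathrm{E}$. Here the dot denotes multiplication of operators, whereas $\partial f,\int f,\mathrm{E}f$ without dot denote elements of $\mathcal{R}$. *)

theory Defs
  imports Main
begin

class differential_ring = ring_1 +
  fixes der :: "'a \<Rightarrow> 'a"
  assumes der_add: "der (f + g) = der f + der g"
    and der_mult: "der (f * g) = der f * g + f * der g"

definition constants :: "'a::differential_ring set" where
  "constants = {c. der c = 0}"

text \<open>The integral is a homomorphism of bimodules over the constants, hence the two
  linearity axioms \<open>itg_mult_left\<close> and \<open>itg_mult_right\<close>.\<close>

class integro_differential_ring = differential_ring +
  fixes itg :: "'a \<Rightarrow> 'a"
  assumes itg_add: "itg (f + g) = itg f + itg g"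
    and itg_mult_left: "der c = 0 \<Longrightarrow> itg (c * f) = c * itg f"
    and itg_mult_right: "der c = 0 \<Longrightarrow> itg (f * c) = itg f * c"
    and der_itg: "der (itg f) = f"

definition evl :: "'a::integro_differential_ring \<Rightarrow> 'a" where
  "evl f = f - itg (der f)"

lemma der_0 [simp]: "der (0::'a::differential_ring) = 0"
  using der_add[of "0::'a" 0] by simp

lemma der_1 [simp]: "der (1::'a::differential_ring) = 0"
  using der_mult[of "1::'a" 1] by simp

lemma der_minus: "der (- f) = - der (f::'a::differential_ring)"
  by (rule minus_unique[symmetric]) (simp flip: der_add)

lemma der_diff: "der (f - g) = der f - der (g::'a::differential_ring)"
  using der_add[of f "- g"] by (simp add: der_minus)

lemma itg_0 [simp]: "itg (0::'a::integro_differential_ring) = 0"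
  using itg_add[of "0::'a" 0] by simp

lemma itg_minus: "itg (- f) = - itg (f::'a::integro_differential_ring)"
  by (rule minus_unique[symmetric]) (simp flip: itg_add)

lemma der_evl [simp]: "der (evl f) = 0"
  by (simp add: evl_def der_diff der_itg)

lemma evl_in_constants: "evl f \<in> constants"
  by (simp add: constants_def)

lemma evl_add: "evl (f + g) = evl f + evl g"
  by (simp add: evl_def der_add itg_add)

lemma evl_minus: "evl (- f) = - evl f"
  by (simp add: evl_def der_minus itg_minus)

lemma evl_mult_left: "der c = 0 \<Longrightarrow> evl (c * f) = c * evl f"
  by (simp add: evl_def der_mult itg_mult_left right_diff_distrib)

lemma evl_mult_right: "der c = 0 \<Longrightarrow> evl (f * c) = evl f * c"
  by (simp add: evl_def der_mult itg_mult_right left_diff_distrib)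


text \<open>The ring of integro-differential operators is defined by its presentation: ring
  expressions over the coefficients and the three indeterminates, modulo the least congruence
  that satisfies the ring laws, makes \<open>Coeff\<close> a unital ring homomorphism and
  contains the defining relations. The zero and the unit of the operator ring are the
  classes of \<open>Coeff 0\<close> and \<open>Coeff 1\<close>.\<close>

datatype 'a ido_expr =
    Coeff 'a | Der | Itg | Evl
  | Add "'a ido_expr" "'a ido_expr"
  | Neg "'a ido_expr"
  | Mul "'a ido_expr" "'a ido_expr"

inductive ido_eq ::
  "'a::integro_differential_ring ido_expr \<Rightarrow> 'a ido_expr \<Rightarrow> bool" where
  ido_refl: "ido_eq x x"
| ido_sym: "ido_eq x y \<Longrightarrow> ido_eq y x"
| ido_trans: "ido_eq x y \<Longrightarrow> ido_eq y z \<Longrightarrow> ido_eq x z"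
| cong_Add: "ido_eq x x' \<Longrightarrow> ido_eq y y' \<Longrightarrow> ido_eq (Add x y) (Add x' y')"
| cong_Neg: "ido_eq x x' \<Longrightarrow> ido_eq (Neg x) (Neg x')"
| cong_Mul: "ido_eq x x' \<Longrightarrow> ido_eq y y' \<Longrightarrow> ido_eq (Mul x y) (Mul x' y')"
| ido_add_assoc: "ido_eq (Add (Add x y) z) (Add x (Add y z))"
| ido_add_comm: "ido_eq (Add x y) (Add y x)"
| ido_add_zero: "ido_eq (Add (Coeff 0) x) x"
| ido_add_neg: "ido_eq (Add (Neg x) x) (Coeff 0)"
| ido_mul_assoc: "ido_eq (Mul (Mul x y) z) (Mul x (Mul y z))"
| ido_mul_one_left: "ido_eq (Mul (Coeff 1) x) x"
| ido_mul_one_right: "ido_eq (Mul x (Coeff 1)) x"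
| ido_distrib_left: "ido_eq (Mul x (Add y z)) (Add (Mul x y) (Mul x z))"
| ido_distrib_right: "ido_eq (Mul (Add x y) z) (Add (Mul x z) (Mul y z))"
| coeff_add: "ido_eq (Coeff (f + g)) (Add (Coeff f) (Coeff g))"
| coeff_mult: "ido_eq (Coeff (f * g)) (Mul (Coeff f) (Coeff g))"
| const_Der: "c \<in> constants \<Longrightarrow> ido_eq (Mul Der (Coeff c)) (Mul (Coeff c) Der)"
| const_Itg: "c \<in> constants \<Longrightarrow> ido_eq (Mul Itg (Coeff c)) (Mul (Coeff c) Itg)"
| const_Evl: "c \<in> constants \<Longrightarrow> ido_eq (Mul Evl (Coeff c)) (Mul (Coeff c) Evl)"
| Der_coeff: "ido_eq (Mul Der (Coeff f)) (Add (Mul (Coeff f) Der) (Coeff (der f)))"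
| Der_Itg: "ido_eq (Mul Der Itg) (Coeff 1)"
| Itg_Der: "ido_eq (Mul Itg Der) (Add (Coeff 1) (Neg Evl))"
| Der_coeff_Evl: "ido_eq (Mul (Mul Der (Coeff f)) Evl) (Mul (Coeff (der f)) Evl)"
| Itg_coeff_Evl: "ido_eq (Mul (Mul Itg (Coeff f)) Evl) (Mul (Coeff (itg f)) Evl)"
| Evl_coeff_Evl: "ido_eq (Mul (Mul Evl (Coeff f)) Evl) (Mul (Coeff (evl f)) Evl)"

text \<open>The action of expressions on the coefficient ring; it shows that the coefficients embed
  into the quotient, in particular that the quotient is nonzero.\<close>

primrec act :: "'a::integro_differential_ring ido_expr \<Rightarrow> 'a \<Rightarrow> 'a" where
  "act (Coeff f) u = f * u"
| "act Der u = der u"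
| "act Itg u = itg u"
| "act Evl u = evl u"
| "act (Add x y) u = act x u + act y u"
| "act (Neg x) u = - act x u"
| "act (Mul x y) u = act x (act y u)"

lemma act_add: "act x (u + v) = act x u + act x v"
  by (induction x arbitrary: u v)
    (simp_all add: der_add itg_add evl_add distrib_left add_ac)

lemma act_cong: "ido_eq x y \<Longrightarrow> act x u = act y u"
proof (induction arbitrary: u rule: ido_eq.induct)
  case (Itg_Der u)
  then show ?case by (simp add: evl_def)
qed (simp_all add: act_add constants_def der_mult der_itg itg_mult_left itg_mult_right
      evl_mult_left evl_mult_right distrib_right mult.assoc add_ac)

quotient_type (overloaded) 'a ido = "'a::integro_differential_ring ido_expr" / ido_eq
  by (rule equivpI)
    (auto intro: reflpI sympI transpI ido_eq.ido_refl ido_eq.ido_sym ido_eq.ido_trans)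

instantiation ido :: (integro_differential_ring) ring_1
begin

lift_definition zero_ido :: "'a ido" is "Coeff 0" .
lift_definition one_ido :: "'a ido" is "Coeff 1" .
lift_definition plus_ido :: "'a ido \<Rightarrow> 'a ido \<Rightarrow> 'a ido" is Add
  by (rule ido_eq.cong_Add)
lift_definition uminus_ido :: "'a ido \<Rightarrow> 'a ido" is Neg
  by (rule ido_eq.cong_Neg)
lift_definition minus_ido :: "'a ido \<Rightarrow> 'a ido \<Rightarrow> 'a ido" is "\<lambda>x y. Add x (Neg y)"
  by (intro ido_eq.cong_Add ido_eq.cong_Neg)
lift_definition times_ido :: "'a ido \<Rightarrow> 'a ido \<Rightarrow> 'a ido" is Mul
  by (rule ido_eq.cong_Mul)

instance
proof
  show "(0::'a ido) \<noteq> 1"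
  proof (transfer, rule notI)
    assume "ido_eq (Coeff 0) (Coeff (1::'a))"
    from act_cong[OF this, of 1] show False
      by simp
  qed
qed (transfer,
    rule ido_eq.ido_add_assoc ido_eq.ido_add_comm ido_eq.ido_add_zero ido_eq.ido_add_neg
      ido_eq.ido_mul_assoc ido_eq.ido_mul_one_left ido_eq.ido_mul_one_right
      ido_eq.ido_distrib_left ido_eq.ido_distrib_right
      ido_eq.ido_refl)+

end

lift_definition coeff :: "'a::integro_differential_ring \<Rightarrow> 'a ido" is Coeff .
lift_definition derivation_op :: "'a::integro_differential_ring ido" is Der .
lift_definition integral_op :: "'a::integro_differential_ring ido" is Itg .
lift_definition evaluation_op :: "'a::integro_differential_ring ido" is Evl .

lemma inj_coeff: "inj coeff"
proof (rule injI)
  fix f g :: 'a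
  assume "coeff f = coeff g"
  then have "ido_eq (Coeff f) (Coeff g)"
    by transfer
  from act_cong[OF this, of 1] show "f = g"
    by simp
qed

end

theory Submission
  imports Defs
begin

text \<open>Since \<open>z\<close> solves \<open>\<partial>z + az = 0\<close>, the Leibniz rule gives the factorization
  \<open>L \<cdot> z = z \<cdot> \<partial>\<close>, and \<open>\<partial>\<close> cancels against \<open>\<integral>\<close>.\<close>

lemma one_ido_eq_coeff: "1 = coeff 1"
  by transfer (rule ido_refl)

lemma zero_ido_eq_coeff: "0 = coeff 0"
  by transfer (rule ido_refl)

lemma coeff_plus: "coeff (f + g) = coeff f + coeff g"
  by transfer (rule coeff_add)

lemma coeff_times: "coeff (f * g) = coeff f * coeff g"
  by transfer (rule coeff_mult)

lemma derivation_op_mult_coeff: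
  "derivation_op * coeff f = coeff f * derivation_op + coeff (der f)"
  by transfer (rule Der_coeff)

lemma derivation_op_mult_integral_op: "derivation_op * integral_op = 1"
  by transfer (rule Der_Itg)

lemma first_order_op_mult_solution:
  assumes "der z + a * z = 0"
  shows "(derivation_op + coeff a) * coeff z = coeff z * derivation_op"
proof -
  \<comment> \<open>Moving \<open>derivation_op\<close> past \<open>coeff z\<close> leaves the term
    \<open>coeff (der z)\<close>, which merges with \<open>coeff a * coeff z\<close> into a single
    coefficient that the equation for \<open>z\<close> makes zero.\<close>
  have "(derivation_op + coeff a) * coeff z =
      coeff z * derivation_op + coeff (der z + a * z)"
    by (simp add: distrib_right derivation_op_mult_coeff coeff_plus coeff_times add.assoc)
  then show ?thesis
    by (simp add: assms flip: zero_ido_eq_coeff)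
qed

theorem theorem5p3:
  fixes a z z_inv :: "'a::integro_differential_ring"
  assumes "der z + a * z = 0"
    and "z * z_inv = 1"
  shows "(derivation_op + coeff a) * (coeff z * integral_op * coeff z_inv) = 1"
proof -
  have "(derivation_op + coeff a) * (coeff z * integral_op * coeff z_inv) =
      ((derivation_op + coeff a) * coeff z) * integral_op * coeff z_inv"
    by (simp only: mult.assoc)
  also have "\<dots> = coeff z * (derivation_op * integral_op) * coeff z_inv"
    by (simp only: first_order_op_mult_solution[OF assms(1)] mult.assoc)
  \<comment> \<open>Once the inner product has become 1, the outer coefficients meet in the order
    \<open>z * z_inv\<close>, exactly the product that a right inverse controls in a noncommutative
    ring.\<close>
  also have "\<dots> = coeff (z * z_inv)"
    by (simp add: derivation_op_mult_integral_op coeff_times)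
  also have "\<dots> = 1"
    by (simp add: assms(2) one_ido_eq_coeff)
  finally show ?thesis .
qed

end
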